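(* Let $r\ge 4$ be even and let all $k_i\geq 1$ be integers. Then \[ \begin{array}{rll} \mathcal{F}[2,k_2,\ldots,k_r] & = & \mathcal{F}(k_2-1,k_3,\ldots,k_{r-1},k_r-1)+ \mathcal{F}(k_3-1,k_4,\ldots,k_{r-2},k_{r-1}-1), \\ \mathcal{F}[1,k_2,\ldots,k_r] & = & \mathcal{F}(k_3-1,k_4,\ldots,k_{r-2},k_{r-1}-1) + \mathcal{F}(k_4-1,k_5,\ldots,k_{r-1},k_r-1) \ + \\ & & \mathcal{F}(k_2-1,k_3,\ldots,k_{r-3},k_{r-2}-1) - \mathcal{F}(k_4-1,k_5,\ldots,k_{r-3},k_{r-2}-1). \end{array} \] Also, $\mathcal{F}[k]=2$ for $k\geq 3$; $\mathcal{F}[k,1]=2$ for $k\geq 2$; and $\mathcal{F}[k_1,k_2]=3$ for $k_1,k_2\geq 2$.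
   Context: Open chain AND-OR networks. For $n\ge 2$ and operators $\diamondsuit_2,\ldots,\diamondsuit_{n-1}\in\{\wedge,\vee\}$ (logical AND, OR), the AND-OR network with open chain topology is $f:\{0,1\}^n\to\{0,1\}^n$ with $f_1(x)=x_2$, $f_i(x)=x_{i-1}\diamondsuit_i x_{i+1}$ for $2\le i\le n-1$, and $f_n(x)=x_{n-1}$. For positive integers $k_1,\ldots,k_m$ with $k_1+\cdots+k_m=n-2$, the sequence $(k_1,\ldots,k_m)$ represents the network whose operator sequence $\diamondsuit_2,\ldots,\diamondsuit_{n-1}$ consists of $m$ consecutive runs of lengths $k_1,\ldots,k_m$, the operator being constant in each run and alternating between $\wedge$ and $\vee$ from one run to the next. $\mathcal{F}(k_1,\ldots,k_m)$ (round parentheses) is the number of fixed points ($x$ with $f(x)=x$) of this network. Closed chain AND-OR networks. These are the networks $f_i(x)=x_{i-1}\diamondsuit_i x_{i+1}$, $i=1,\ldots,n$, with indices of the variables read modulo $n$ and $\diamondsuit_i\in\{\wedge,\vee\}$. Such a network is denoted $[k_1,\ldots,k_r]$, where $k_1,\ldots,k_r\ge1$ are the lengths of the maximal runs of equal operators in the cyclic sequence $\diamondsuit_1,\ldots,\diamondsuit_n$, listed in cyclic order (any cyclic permutation denotes the same network up to relabeling); hence $k_1+\cdots+k_r=n$, operators alternate from run to run, and $r$ is always even or equal to $1$ ($r=1$ meaning that all operators are equal). $\mathcal{F}[k_1,\ldots,k_r]$ (square brackets) is its number of fixed points. In both cases the number of fixed points does not depend on whether the first run is $\wedge$ or $\vee$.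 Conventions: (i) The empty sequence $()$ denotes the open chain network $f(x_1,x_2)=(x_2,x_1)$, and zero entries at either end of an open chain sequence are deleted: $\mathcal{F}(0,k_1,\ldots,k_m,0)=\mathcal{F}(k_1,\ldots,k_m,0)=\mathcal{F}(0,k_1,\ldots,k_m)=\mathcal{F}(k_1,\ldots,k_m)$, and $\mathcal{F}(0)=\mathcal{F}()$. (ii) $\mathcal{F}(-1)=1$. (iii) A sequence of the form $(k_s-1,k_{s+1},\ldots,k_{t-1},k_t-1)$ is understood as follows in the degenerate cases: if $s=t$ it means the one-term sequence $(k_s-2)$; if $s>t$ it means the one-term sequence $(-1)$. *)

theory Defs
  imports Main
begin

datatype gate = And | Or

fun apply_gate :: "gate \<Rightarrow> bool \<Rightarrow> bool \<Rightarrow> bool" where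
  "apply_gate And a b \<longleftrightarrow> a \<and> b"
| "apply_gate Or a b \<longleftrightarrow> a \<or> b"

fun dual :: "gate \<Rightarrow> gate" where
  "dual And = Or"
| "dual Or = And"

text \<open>
  States in \<open>{0,1}\<close> to the power \<open>n\<close> are Boolean lists of length \<open>n\<close>, indexed from 0, so the
  entry \<open>x ! i\<close> is the variable with number \<open>i + 1\<close>.
\<close>

definition num_fixed_points :: "nat \<Rightarrow> (bool list \<Rightarrow> bool list) \<Rightarrow> nat" where
  "num_fixed_points n f = card {x. length x = n \<and> f x = x}"

text \<open>
  The argument of \<open>open_net\<close> lists the operators of the \<open>n - 2\<close> interior vertices; hence
  \<open>n = length ops + 2\<close>, and the operator of the vertex with index \<open>i\<close> is \<open>ops ! (i - 1)\<close>.
\<close>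

definition open_net :: "gate list \<Rightarrow> bool list \<Rightarrow> bool list" where
  "open_net ops x =
    (let n = length ops + 2 in
      map (\<lambda>i. if i = 0 then x ! 1
               else if i = n - 1 then x ! (n - 2)
               else apply_gate (ops ! (i - 1)) (x ! (i - 1)) (x ! (i + 1))) [0..<n])"

definition closed_net :: "gate list \<Rightarrow> bool list \<Rightarrow> bool list" where
  "closed_net ops x =
    (let n = length ops in
      map (\<lambda>i. apply_gate (ops ! i) (x ! ((i + n - 1) mod n)) (x ! ((i + 1) mod n))) [0..<n])"

text \<open>Runs of the given lengths, alternating between the two operators and starting with \<open>g\<close>.\<close>

fun run_ops :: "gate \<Rightarrow> nat list \<Rightarrow> gate list" where
  "run_ops g [] = []"
| "run_ops g (k # ks) = replicate k g @ run_ops (dual g) ks"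

definition strip_zeros :: "int list \<Rightarrow> int list" where
  "strip_zeros ks = rev (dropWhile (\<lambda>k. k = 0) (rev (dropWhile (\<lambda>k. k = 0) ks)))"

text \<open>
  The number of fixed points of the open chain network written with round parentheses.  Entries are
  integers because the one-term sequence \<open>[-1]\<close> is assigned the value 1 by convention; no other
  sequence with negative entries is meaningful.  The first run is taken to be \<open>And\<close>; by lemma
  \<open>num_fixed_points_open_start\<close> below this choice is immaterial.
\<close>

definition open_fp :: "int list \<Rightarrow> nat" where
  "open_fp ks =
    (if ks = [-1] then 1
     else let ops = run_ops And (map nat (strip_zeros ks))
          in num_fixed_points (length ops + 2) (open_net ops))"

text \<open>
  The number of fixed points of the closed chain network written with square brackets.  It is
  meaningful for lists of positive numbers whose length is 1 or even.  The choice of the first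
  operator and of the run listed first are immaterial: see \<open>num_fixed_points_closed_start\<close> and
  \<open>closed_fp_rotate1\<close> below.
\<close>

definition closed_fp :: "nat list \<Rightarrow> nat" where
  "closed_fp ks =
    (let ops = run_ops And ks in num_fixed_points (length ops) (closed_net ops))"

text \<open>
  The sequence \<open>(k s - 1, k (s + 1), \<dots>, k (t - 1), k t - 1)\<close>, together with its conventional
  meaning when it has at most one term.
\<close>

definition trimmed :: "(nat \<Rightarrow> nat) \<Rightarrow> nat \<Rightarrow> nat \<Rightarrow> int list" where
  "trimmed k s t =
    (if s < t then [int (k s) - 1] @ map (\<lambda>i. int (k i)) [s + 1..<t] @ [int (k t) - 1]
     else if s = t then [int (k s) - 2]
     else [-1])"

lemma dual_dual [simp]: "dual (dual g) = g"
  by (cases g) auto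

lemma apply_gate_dual: "apply_gate (dual g) (\<not> a) (\<not> b) \<longleftrightarrow> \<not> apply_gate g a b"
  by (cases g) auto

lemma run_ops_dual: "run_ops (dual g) ks = map dual (run_ops g ks)"
  by (induction ks arbitrary: g) (auto simp: comp_def)

lemma length_run_ops [simp]: "length (run_ops g ks) = sum_list ks"
  by (induction ks arbitrary: g) auto

lemma num_fixed_points_conj:
  assumes bij: "bij_betw h {x. length x = n} {x. length x = n}"
    and len: "\<And>x. length x = n \<Longrightarrow> length (f x) = n"
    and comm: "\<And>x. length x = n \<Longrightarrow> g (h x) = h (f x)"
  shows "num_fixed_points n g = num_fixed_points n f"
proof -
  have inj: "inj_on h {x. length x = n}" and im: "h ` {x. length x = n} = {x. length x = n}"
    using bij by (auto simp: bij_betw_def)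
  have "{y. length y = n \<and> g y = y} = h ` {x. length x = n \<and> f x = x}" (is "?L = ?R")
  proof (intro equalityI subsetI)
    fix y assume y: "y \<in> ?L"
    then have "y \<in> h ` {x. length x = n}" by (simp add: im)
    then obtain x where x: "length x = n" "h x = y" by blast
    with y comm[of x] have "h (f x) = h x" by auto
    with inj len[of x] x have "f x = x" by (auto dest: inj_onD)
    with x show "y \<in> ?R" by auto
  next
    fix y assume "y \<in> ?R"
    then obtain x where x: "length x = n" "f x = x" "y = h x" by auto
    have "h x \<in> h ` {x. length x = n}" using x by blast
    then have "length y = n" using x by (simp add: im)
    with x comm[of x] show "y \<in> ?L" by auto
  qed
  moreover have "inj_on h {x. length x = n \<and> f x = x}"
    using inj by (rule inj_on_subset) auto
  ultimately show ?thesis by (simp add: num_fixed_points_def card_image)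
qed

lemma length_open_net [simp]: "length (open_net ops x) = length ops + 2"
  by (simp add: open_net_def Let_def del: upt_Suc)

lemma nth_open_net:
  assumes "i < length ops + 2"
  shows "open_net ops x ! i =
    (if i = 0 then x ! 1
     else if i = length ops + 1 then x ! length ops
     else apply_gate (ops ! (i - 1)) (x ! (i - 1)) (x ! (i + 1)))"
  using assms by (simp add: open_net_def Let_def del: upt_Suc)

lemma length_closed_net [simp]: "length (closed_net ops x) = length ops"
  by (simp add: closed_net_def Let_def)

lemma bij_betw_map_Not: "bij_betw (map Not) {x. length x = n} {x. length x = n}"
  by (rule bij_betw_byWitness[where f' = "map Not"]) (auto simp: comp_def)

lemma num_fixed_points_open_dual:
  "num_fixed_points (length ops + 2) (open_net (map dual ops)) =
   num_fixed_points (length ops + 2) (open_net ops)"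
proof (rule num_fixed_points_conj[OF bij_betw_map_Not])
  fix x :: "bool list" assume len: "length x = length ops + 2"
  show "open_net (map dual ops) (map Not x) = map Not (open_net ops x)"
  proof (rule nth_equalityI)
    fix i assume "i < length (open_net (map dual ops) (map Not x))"
    then have i: "i < length ops + 2" by simp
    consider "i = 0" | "i = length ops + 1" | "0 < i" "i < length ops + 1" using i by linarith
    then show "open_net (map dual ops) (map Not x) ! i = map Not (open_net ops x) ! i"
    proof cases
      case 3
      then have "i - 1 < length ops" "i - 1 < length x" "i + 1 < length x" using len by linarith+
      with 3 show ?thesis by (simp add: nth_open_net apply_gate_dual)
    qed (use len in \<open>simp_all add: nth_open_net\<close>)
  qed simp
qed simp

lemma num_fixed_points_closed_dual:
  "num_fixed_points (length ops) (closed_net (map dual ops)) =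
   num_fixed_points (length ops) (closed_net ops)"
proof (rule num_fixed_points_conj[OF bij_betw_map_Not])
  fix x :: "bool list" assume len: "length x = length ops"
  show "closed_net (map dual ops) (map Not x) = map Not (closed_net ops x)"
  proof (rule nth_equalityI)
    fix i assume "i < length (closed_net (map dual ops) (map Not x))"
    then have i: "i < length ops" by simp
    then have "j mod length ops < length ops" for j by (intro mod_less_divisor) linarith
    with i len show "closed_net (map dual ops) (map Not x) ! i = map Not (closed_net ops x) ! i"
      by (simp add: closed_net_def Let_def apply_gate_dual)
  qed simp
qed simp

lemma num_fixed_points_open_start:
  "(let ops = run_ops g ks in num_fixed_points (length ops + 2) (open_net ops)) =
   (let ops = run_ops And ks in num_fixed_points (length ops + 2) (open_net ops))"
  using num_fixed_points_open_dual[of "run_ops And ks"]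
  by (cases g) (simp_all add: Let_def flip: run_ops_dual)

lemma num_fixed_points_closed_start:
  "(let ops = run_ops g ks in num_fixed_points (length ops) (closed_net ops)) = closed_fp ks"
  using num_fixed_points_closed_dual[of "run_ops And ks"]
  by (cases g) (simp_all add: closed_fp_def Let_def flip: run_ops_dual)

lemma bij_betw_rotate1: "bij_betw rotate1 {x :: 'a list. length x = n} {x. length x = n}"
proof -
  have "inj_on rotate1 {x :: 'a list. length x = n}"
    using inj_rotate1 by (rule inj_on_subset) simp
  moreover have "rotate1 ` {x :: 'a list. length x = n} = {x. length x = n}"
  proof (intro equalityI subsetI)
    fix y :: "'a list" assume y: "y \<in> {x. length x = n}"
    obtain x where x: "y = rotate1 x" using surj_rotate1 by (meson surjD)
    with y have "length x = n" by auto
    with x show "y \<in> rotate1 ` {x. length x = n}" by blast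
  qed auto
  ultimately show ?thesis by (simp add: bij_betw_def)
qed

lemma num_fixed_points_closed_rotate1:
  "num_fixed_points (length ops) (closed_net (rotate1 ops)) =
   num_fixed_points (length ops) (closed_net ops)"
proof (rule num_fixed_points_conj[OF bij_betw_rotate1])
  fix x :: "bool list" assume len: "length x = length ops"
  show "closed_net (rotate1 ops) (rotate1 x) = rotate1 (closed_net ops x)"
  proof (rule nth_equalityI)
    fix i assume "i < length (closed_net (rotate1 ops) (rotate1 x))"
    then have i: "i < length ops" by simp
    have "Suc ((i + length ops - Suc 0) mod length ops) mod length ops
        = (Suc i mod length ops + length ops - Suc 0) mod length ops"
    proof -
      have "Suc (i + length ops - Suc 0) = i + length ops" using i by linarith
      then have "Suc ((i + length ops - Suc 0) mod length ops) mod length ops = i"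
        using i by (simp add: mod_Suc_eq)
      moreover have "(Suc i mod length ops + length ops - Suc 0) mod length ops = i"
        using i by (cases "Suc i = length ops") simp_all
      ultimately show ?thesis by simp
    qed
    moreover have "Suc i mod length ops < length ops"
      "(i + length ops - Suc 0) mod length ops < length ops"
      using i by (intro mod_less_divisor, linarith)+
    ultimately show "closed_net (rotate1 ops) (rotate1 x) ! i = rotate1 (closed_net ops x) ! i"
      using i len by (simp add: closed_net_def Let_def nth_rotate1)
  qed simp
qed simp

lemma num_fixed_points_closed_rotate:
  "num_fixed_points (length ops) (closed_net (rotate m ops)) =
   num_fixed_points (length ops) (closed_net ops)"
proof (induction m)
  case (Suc m)
  then show ?case using num_fixed_points_closed_rotate1[of "rotate m ops"] by simp
qed simp

lemma run_ops_snoc: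
  "run_ops g (ks @ [k]) = run_ops g ks @ replicate k (if even (length ks) then g else dual g)"
  by (induction ks arbitrary: g) auto

lemma closed_fp_rotate1:
  assumes "length ks = 1 \<or> even (length ks)"
  shows "closed_fp (rotate1 ks) = closed_fp ks"
proof (cases "\<exists>k ks'. ks = k # ks' \<and> ks' \<noteq> []")
  case True
  then obtain k ks' where ks: "ks = k # ks'" "ks' \<noteq> []" by blast
  with assms have "odd (length ks')" by auto
  then have eq: "run_ops Or (rotate1 ks) = rotate k (run_ops And ks)"
    using rotate_append[of "replicate k And" "run_ops Or ks'"] ks
    by (simp add: run_ops_snoc)
  have "closed_fp (rotate1 ks) =
      (let ops = run_ops Or (rotate1 ks) in num_fixed_points (length ops) (closed_net ops))"
    by (rule num_fixed_points_closed_start[symmetric])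
  then show ?thesis
    using num_fixed_points_closed_rotate[of "run_ops And ks" k]
    unfolding eq by (simp add: Let_def closed_fp_def)
next
  case False
  then show ?thesis by (cases ks) auto
qed

end

theory Submission
  imports Defs
begin

text \<open>
  A fixed point of a chain network is a Boolean word in which every letter is the gate value of its
  two neighbours.  Call 1 the neutral value of \<open>And\<close> and 0 the neutral value of \<open>Or\<close>; the neutral
  value of one gate is the absorbing value of the other.  Two facts about these values carry the
  proof.

  A neutral neighbour makes a gate copy its other neighbour, which is just what the end vertices of
  an open chain do.  So the trimmed open chain of \<open>(k s - 1, \<dots>, k t - 1)\<close> is the piece with the
  full runs \<open>(k s, \<dots>, k t)\<close>, placed between two fixed values that are neutral for its first and
  its last gate (\<open>open_fp_trimmed\<close>).  This reading also explains the conventional value 1 of the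
  sequence \<open>(-1)\<close> when \<open>s = t\<close>: the piece then is one gate between two neutral values, which
  has exactly one solution.

  An absorbing neighbour forces the value of a gate, and the forced value is again the absorbing one.
  So an absorbing value sweeps through a whole run and meets the next run as a neutral value.  A
  pair of adjacent neutral values likewise forces a whole run to be constant, and meets the next run
  as an absorbing value.

  The recursions now come from a case distinction on a short \<open>And\<close> run, whose two neighbouring
  runs are of type \<open>Or\<close>.  In a run of length 2 the two vertices have equal values.  If both are 0,
  the rest of the cycle is the piece \<open>k 2, \<dots>, k r\<close> between two zeros, and zero is neutral for \<open>Or\<close>.
  If both are 1, their outer neighbours must be 1 too; the value 1 sweeps through the runs 2 and \<open>r\<close>
  and leaves the piece \<open>k 3, \<dots>, k (r - 1)\<close> between two ones.  In a run of length 1, the value 1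
  leads to the same piece \<open>k 3, \<dots>, k (r - 1)\<close>.  The value 0 requires that at least one neighbour
  is 0, and inclusion-exclusion over the two neighbours gives the other three terms: a zero next to
  the zero vertex clears the runs 2 and 3 if it lies on the one side, and the runs \<open>r\<close> and
  \<open>r - 1\<close> if it lies on the other.

  Solutions are counted by transfer operators on the values of two consecutive vertices.  These
  operators form a monoid action of gate lists, so both ends of a chain can be simplified
  independently.
\<close>

section \<open>Chains between prescribed values\<close>

text \<open>
  The sum of \<open>\<phi>\<close> over the last two letters of all words that start with \<open>a b\<close> and obey the gates,
  the first gate sitting at \<open>b\<close>.  As an operator on \<open>\<phi>\<close> this is a product of transfer matrices
  indexed by pairs of letters; \<open>card_consistent\<close> proves the reading as a count.
\<close>

fun weight :: "gate list \<Rightarrow> (bool \<Rightarrow> bool \<Rightarrow> nat) \<Rightarrow> bool \<Rightarrow> bool \<Rightarrow> nat" where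
  "weight [] \<phi> a b = \<phi> a b"
| "weight (g # w) \<phi> a b =
     of_bool (b = apply_gate g a False) * weight w \<phi> b False +
     of_bool (b = apply_gate g a True) * weight w \<phi> b True"

definition weight_from :: "gate list \<Rightarrow> (bool \<Rightarrow> bool \<Rightarrow> nat) \<Rightarrow> bool \<Rightarrow> nat" where
  "weight_from w \<phi> a = weight w \<phi> a False + weight w \<phi> a True"

definition ends_in :: "bool \<Rightarrow> bool \<Rightarrow> bool \<Rightarrow> nat" where
  "ends_in d c e = of_bool (e = d)"

definition ends_in_pair :: "bool \<Rightarrow> bool \<Rightarrow> bool \<Rightarrow> bool \<Rightarrow> nat" where
  "ends_in_pair a b c e = of_bool (c = a \<and> e = b)"

definition ends_equal :: "bool \<Rightarrow> bool \<Rightarrow> nat" where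
  "ends_equal c e = of_bool (c = e)"

text \<open>
  The neutral element of the gate as a binary operation.  The absorbing element is its negation,
  so \<open>neutral g \<noteq> a\<close> below says that \<open>a\<close> is absorbing for \<open>g\<close>.
\<close>

definition neutral :: "gate \<Rightarrow> bool" where
  "neutral g \<longleftrightarrow> g = And"

lemma neutral_simps [simp]: "neutral And" "\<not> neutral Or"
  by (simp_all add: neutral_def)

lemma weight_append: "weight (v @ w) \<phi> = weight v (weight w \<phi>)"
proof (induction v)
  case (Cons g v)
  then show ?case by (intro ext) simp
qed (simp add: fun_eq_iff)

lemma weight_Cons: "weight (g # w) \<phi> = weight [g] (weight w \<phi>)"
  using weight_append[of "[g]" w \<phi>] by (simp del: weight.simps)

lemma weight_from_append: "weight_from (v @ w) \<phi> a = weight_from v (weight w \<phi>) a"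
  by (simp add: weight_from_def weight_append)

lemma weight_add:
  "weight w (\<lambda>c e. \<phi> c e + \<psi> c e) a b = weight w \<phi> a b + weight w \<psi> a b"
  by (induction w arbitrary: a b) (simp_all add: UNIV_bool algebra_simps)

text \<open>
  This is the source of the inclusion-exclusion: leaving the last but one letter free merges two
  boundary conditions.
\<close>

lemma weight_sum_ends_in_pair:
  "weight w (ends_in_pair False d) a b + weight w (ends_in_pair True d) a b =
   weight w (ends_in d) a b"
proof -
  have "ends_in d = (\<lambda>c e. ends_in_pair False d c e + ends_in_pair True d c e)"
    by (auto simp: fun_eq_iff ends_in_def ends_in_pair_def)
  then show ?thesis by (simp add: weight_add)
qed

section \<open>Neutral and absorbing values\<close>

text \<open>
  A gate with a neutral left neighbour copies its right neighbour, just like the first vertex of an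
  open chain.
\<close>

lemma weight_from_neutral:
  "weight_from (g # w) \<phi> (neutral g) = (\<Sum>c\<in>UNIV. weight w \<phi> c c)"
  by (cases g) (simp_all add: weight_from_def UNIV_bool)

text \<open>
  The mirror image of the previous lemma, for the last vertex.
\<close>

lemma weight_neutral: "weight [g] (ends_in (neutral g)) = ends_equal"
  by (intro ext, cases g) (auto simp: ends_in_def ends_equal_def UNIV_bool)

text \<open>
  An absorbing left neighbour fixes the gate to that same value, which is then the left neighbour of
  the next gate.  Hence the whole run is forced and can be deleted.
\<close>

lemma weight_from_absorbing:
  assumes "neutral g \<noteq> a"
  shows "weight_from (replicate m g @ w) \<phi> a = weight_from w \<phi> a"
proof (induction m)
  case (Suc m)
  have "weight_from (g # v) \<phi> a = weight_from v \<phi> a" for v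
    using assms by (cases g; cases a) (simp_all add: weight_from_def UNIV_bool)
  with Suc show ?case by simp
qed simp

text \<open>
  The sweep from the right: the boundary condition behind the run may be moved in front of it.
\<close>

lemma weight_absorbing:
  assumes "neutral g \<noteq> d"
  shows "weight (replicate m g) (ends_in d) = ends_in d"
proof (induction m)
  case (Suc m)
  have "weight [g] (ends_in d) = ends_in d"
    using assms by (intro ext, cases g; cases d) (auto simp: ends_in_def UNIV_bool)
  with Suc show ?case by (simp only: replicate_Suc weight_Cons[of g "replicate m g"])
qed (simp add: fun_eq_iff)

text \<open>
  An absorbing left neighbour lets the gate hold the absorbing value whatever stands on its right.  So
  one vertex of the run is used up to pass from a prescribed pair to a free continuation, and the rest of
  the run is swept.
\<close>

lemma weight_pair_absorbing:
  assumes "neutral g \<noteq> a" "m \<ge> 1"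
  shows "weight (replicate m g @ w) \<phi> a a = weight_from w \<phi> a"
proof -
  obtain l where "m = Suc l" using assms(2) by (cases m) auto
  moreover have "weight (g # v) \<phi> a a = weight_from v \<phi> a" for v
    using assms(1) by (cases g; cases a) (simp_all add: weight_from_def UNIV_bool)
  ultimately show ?thesis using weight_from_absorbing[OF assms(1)] by simp
qed

lemma weight_ends_in_pair_absorbing:
  assumes "neutral g \<noteq> d" "m \<ge> 1"
  shows "weight (replicate m g) (ends_in_pair d d) = ends_in d"
proof -
  obtain l where "m = l + 1" using assms(2) by (metis add.commute le_Suc_ex)
  then have "replicate m g = replicate l g @ [g]" by (simp add: replicate_append_same)
  moreover have "weight [g] (ends_in_pair d d) = ends_in d"
    using assms by (intro ext, cases g; cases d) (auto simp: ends_in_def ends_in_pair_def UNIV_bool)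
  ultimately show ?thesis by (simp only: weight_append weight_absorbing[OF assms(1)])
qed

text \<open>
  Two equal adjacent values that are neutral for the gate force the next letter to be the same, since
  the gate now copies it.
\<close>

lemma weight_pair_neutral:
  assumes "neutral g = a"
  shows "weight (replicate m g @ w) \<phi> a a = weight w \<phi> a a"
proof (induction m)
  case (Suc m)
  have "weight (g # v) \<phi> a a = weight v \<phi> a a" for v
    using assms by (cases g) (auto simp: UNIV_bool)
  with Suc show ?case by simp
qed simp

lemma weight_ends_in_pair_neutral:
  assumes "neutral g = d"
  shows "weight (replicate m g) (ends_in_pair d d) = ends_in_pair d d"
proof (induction m)
  case (Suc m)
  have "weight [g] (ends_in_pair d d) = ends_in_pair d d"
    using assms by (intro ext, cases g) (auto simp: ends_in_pair_def UNIV_bool)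
  with Suc show ?case by (simp only: replicate_Suc weight_Cons[of g "replicate m g"])
qed (simp add: fun_eq_iff)

section \<open>Fixed points as weights\<close>

text \<open>
  The words counted by \<open>weight\<close>: the two outer letters are boundary values without a gate of their
  own.
\<close>

definition consistent :: "gate list \<Rightarrow> bool list \<Rightarrow> bool" where
  "consistent w y \<longleftrightarrow> length y = length w + 2 \<and>
     (\<forall>i<length w. y ! (i + 1) = apply_gate (w ! i) (y ! i) (y ! (i + 2)))"

lemma consistent_Nil: "consistent [] y \<longleftrightarrow> (\<exists>a b. y = [a, b])"
  by (auto simp: consistent_def length_Suc_conv numeral_2_eq_2)

lemma consistent_Cons:
  "consistent (g # w) y \<longleftrightarrow>
   (\<exists>a b c z. y = a # b # c # z \<and> b = apply_gate g a c \<and> consistent w (b # c # z))"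
  unfolding consistent_def
  by (auto simp: length_Suc_conv numeral_2_eq_2 All_less_Suc2)

lemma finite_consistent: "finite {y. consistent w y \<and> P y}"
proof (rule finite_subset)
  show "{y. consistent w y \<and> P y} \<subseteq> {y. set y \<subseteq> UNIV \<and> length y = length w + 2}"
    by (auto simp: consistent_def)
qed (rule finite_lists_length_eq, simp)

lemma card_consistent:
  "card {y. consistent w y \<and> y ! 0 = a \<and> y ! 1 = b \<and>
       P (y ! length w) (y ! (length w + 1))} =
   weight w (\<lambda>c e. of_bool (P c e)) a b"
proof (induction w arbitrary: a b)
  case Nil
  have "{y. consistent [] y \<and> y ! 0 = a \<and> y ! 1 = b \<and> P (y ! 0) (y ! 1)} =
      (if P a b then {[a, b]} else {})"
    by (cases a; cases b) (auto simp: consistent_Nil)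
  then show ?case by simp
next
  case (Cons g w)
  define S where "S c = {y. consistent w y \<and> y ! 0 = b \<and> y ! 1 = c \<and>
    P (y ! length w) (y ! (length w + 1))}" for c
  have fin: "finite (S c)" for c unfolding S_def by (rule finite_consistent)
  have "{y. consistent (g # w) y \<and> y ! 0 = a \<and> y ! 1 = b \<and>
      P (y ! length (g # w)) (y ! (length (g # w) + 1))} =
      (\<Union>c\<in>{c. b = apply_gate g a c}. Cons a ` S c)" (is "?L = ?R")
  proof (intro equalityI subsetI)
    fix y assume "y \<in> ?L"
    then show "y \<in> ?R" by (auto simp: consistent_Cons S_def)
  next
    fix y assume "y \<in> ?R"
    then obtain c y' where y: "b = apply_gate g a c" "y = a # y'" "y' \<in> S c" by blast
    then have "length y' = length w + 2" by (auto simp: S_def consistent_def)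
    then obtain b' c' z where "y' = b' # c' # z" by (auto simp: length_Suc_conv numeral_2_eq_2)
    with y show "y \<in> ?L" by (auto simp: consistent_Cons S_def)
  qed
  moreover have "card (\<Union>c\<in>{c. b = apply_gate g a c}. Cons a ` S c) =
      (\<Sum>c | b = apply_gate g a c. card (Cons a ` S c))"
    by (rule card_UN_disjoint) (auto simp: fin, auto simp: S_def)
  moreover have "card (Cons a ` S c) = weight w (\<lambda>c e. of_bool (P c e)) b c" for c
    using Cons[of b c] by (simp add: card_image S_def)
  moreover have "(\<Sum>c | Q c. f c) = of_bool (Q False) * f False + of_bool (Q True) * f True"
    for Q and f :: "bool \<Rightarrow> nat"
  proof -
    have "{c. Q c} = (if Q False then {False} else {}) \<union> (if Q True then {True} else {})"
    proof (rule set_eqI)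
      show "c \<in> {c. Q c} \<longleftrightarrow>
          c \<in> (if Q False then {False} else {}) \<union> (if Q True then {True} else {})" for c
        by (cases c) simp_all
    qed
    then show ?thesis by simp
  qed
  ultimately show ?case by (simp only: weight.simps)
qed

lemma open_fixed_points:
  "num_fixed_points (length w + 2) (open_net w) = (\<Sum>c\<in>UNIV. weight w ends_equal c c)"
proof -
  define S where "S c = {y. consistent w y \<and> y ! 0 = c \<and> y ! 1 = c \<and>
    y ! length w = y ! (length w + 1)}" for c
  have iff: "open_net w x = x \<longleftrightarrow>
      consistent w x \<and> x ! 0 = x ! 1 \<and> x ! length w = x ! (length w + 1)"
    if len: "length x = length w + 2" for x
  proof -
    have "open_net w x = x \<longleftrightarrow> (\<forall>i<length w + 2. open_net w x ! i = x ! i)"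
      using len by (auto simp: list_eq_iff_nth_eq)
    also have "\<dots> \<longleftrightarrow> open_net w x ! 0 = x ! 0 \<and>
        open_net w x ! (length w + 1) = x ! (length w + 1) \<and>
        (\<forall>i<length w. open_net w x ! (i + 1) = x ! (i + 1))"
    proof -
      have "(\<forall>i<length w + 2. Q i) \<longleftrightarrow> Q 0 \<and> Q (length w + 1) \<and> (\<forall>i<length w. Q (i + 1))"
        for Q
        using All_less_Suc2[of "length w + 1" Q] All_less_Suc[of "length w" "\<lambda>i. Q (Suc i)"]
        by auto
      then show ?thesis .
    qed
    also have "open_net w x ! 0 = x ! 0 \<longleftrightarrow> x ! 0 = x ! 1"
      by (auto simp: nth_open_net)
    also have "open_net w x ! (length w + 1) = x ! (length w + 1) \<longleftrightarrow>
        x ! length w = x ! (length w + 1)"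
      by (simp add: nth_open_net)
    also have "(\<forall>i<length w. open_net w x ! (i + 1) = x ! (i + 1)) \<longleftrightarrow>
        (\<forall>i<length w. x ! (i + 1) = apply_gate (w ! i) (x ! i) (x ! (i + 2)))"
      by (intro all_cong) (auto simp: nth_open_net)
    finally show ?thesis using len by (auto simp: consistent_def)
  qed
  have "{x. length x = length w + 2 \<and> open_net w x = x} = (\<Union>c\<in>UNIV. S c)"
    using iff by (auto simp: S_def) (auto simp: consistent_def)
  moreover have "card (\<Union>c\<in>UNIV. S c) = (\<Sum>c\<in>UNIV. card (S c))"
    by (rule card_UN_disjoint) (auto simp: S_def finite_consistent)
  moreover have "card (S c) = weight w ends_equal c c" for c
    using card_consistent[of w c c "(=)"] by (simp add: S_def ends_equal_def[abs_def])
  ultimately show ?thesis by (simp add: num_fixed_points_def)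
qed

text \<open>
  Unrolling the cycle by one vertex on each side turns a fixed point into a consistent word whose
  first and last pairs of letters agree; the sum over that pair is the trace of the product of
  transfer matrices.
\<close>

lemma closed_fixed_points:
  assumes "length w \<ge> 2"
  shows "num_fixed_points (length w) (closed_net w) =
    (\<Sum>a\<in>UNIV. \<Sum>b\<in>UNIV. weight w (ends_in_pair a b) a b)"
proof -
  let ?n = "length w"
  define S where "S p = {y. consistent w y \<and> (y ! 0, y ! 1) = p \<and>
    (y ! ?n, y ! (?n + 1)) = p}" for p
  define wrap where "wrap x = last x # x @ [hd x]" for x :: "bool list"
  have nth_wrap: "wrap x ! i = x ! ((i + ?n - 1) mod ?n)"
    if x: "length x = ?n" and i: "i < ?n + 2" for x i
  proof -
    have "x \<noteq> []" using x assms by auto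
    consider "i = 0" | "0 < i" "i < ?n + 1" | "i = ?n + 1" using i by linarith
    then show ?thesis
    proof cases
      case 2
      then obtain j where "i = Suc j" "j < ?n" by (cases i) auto
      with x show ?thesis by (simp add: wrap_def nth_append)
    qed (use x assms \<open>x \<noteq> []\<close> in \<open>auto simp: wrap_def last_conv_nth hd_conv_nth nth_append\<close>)
  qed
  have iff: "closed_net w x = x \<longleftrightarrow> consistent w (wrap x)" if len: "length x = ?n" for x
  proof -
    have "closed_net w x = x \<longleftrightarrow> (\<forall>i<?n. closed_net w x ! i = x ! i)"
      using len by (auto simp: list_eq_iff_nth_eq)
    also have "\<dots> \<longleftrightarrow>
        (\<forall>i<?n. wrap x ! (i + 1) = apply_gate (w ! i) (wrap x ! i) (wrap x ! (i + 2)))"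
    proof -
      have "closed_net w x ! i = apply_gate (w ! i) (wrap x ! i) (wrap x ! (i + 2))"
        "x ! i = wrap x ! (i + 1)" if i: "i < ?n" for i
      proof -
        have "i + 2 + ?n - 1 = (i + 1) + ?n" by simp
        then have "(i + 2 + ?n - 1) mod ?n = (i + 1) mod ?n" by (simp only: mod_add_self2)
        then show "closed_net w x ! i = apply_gate (w ! i) (wrap x ! i) (wrap x ! (i + 2))"
          using i nth_wrap[OF len, of i] nth_wrap[OF len, of "i + 2"]
          by (simp add: closed_net_def Let_def)
        show "x ! i = wrap x ! (i + 1)"
          using i nth_wrap[OF len, of "i + 1"] by simp
      qed
      then have "closed_net w x ! i = x ! i \<longleftrightarrow>
          wrap x ! (i + 1) = apply_gate (w ! i) (wrap x ! i) (wrap x ! (i + 2))"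
        if "i < ?n" for i
        using that by metis
      then show ?thesis by (intro all_cong)
    qed
    finally show ?thesis using len by (auto simp: consistent_def wrap_def)
  qed
  have mem: "y \<in> (\<Union>p\<in>UNIV. S p) \<longleftrightarrow>
      consistent w y \<and> y ! ?n = y ! 0 \<and> y ! (?n + 1) = y ! 1" for y
    by (simp add: S_def)
  have ends: "(c # x @ [d]) ! 1 = hd x" "(c # x @ [d]) ! ?n = last x"
      "(c # x @ [d]) ! (?n + 1) = d" if "length x = ?n" for c d x
  proof -
    have "x \<noteq> []" "w \<noteq> []" using that assms by auto
    then show "(c # x @ [d]) ! 1 = hd x" "(c # x @ [d]) ! ?n = last x"
        "(c # x @ [d]) ! (?n + 1) = d"
      using that assms by (simp_all add: nth_append hd_conv_nth last_conv_nth nth_Cons')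
  qed
  have "wrap ` {x. length x = ?n \<and> closed_net w x = x} = (\<Union>p\<in>UNIV. S p)" (is "?L = ?R")
  proof (intro equalityI subsetI)
    fix y assume "y \<in> ?L"
    then obtain x where "length x = ?n" "consistent w (wrap x)" "y = wrap x"
      using iff by blast
    then show "y \<in> ?R" unfolding mem using ends[of x "last x" "hd x"] by (simp add: wrap_def)
  next
    fix y assume "y \<in> ?R"
    then have y: "consistent w y" "y ! ?n = y ! 0" "y ! (?n + 1) = y ! 1"
      unfolding mem by blast+
    then have "length y = Suc (Suc ?n)" by (simp add: consistent_def)
    then obtain c z where "y = c # z" "length z = Suc ?n" by (metis length_Suc_conv)
    then obtain x d where x: "y = c # x @ [d]" "length x = ?n"
      by (metis length_Suc_conv_rev)
    then have "y = wrap x" using y(2,3) ends[of x c d] by (simp add: wrap_def)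
    then show "y \<in> ?L" using iff[of x] x y(1) by blast
  qed
  moreover have "inj wrap" by (auto simp: inj_def wrap_def)
  then have "inj_on wrap {x. length x = ?n \<and> closed_net w x = x}"
    by (rule inj_on_subset) simp
  ultimately have "card {x. length x = ?n \<and> closed_net w x = x} = card (\<Union>p\<in>UNIV. S p)"
    using card_image by fastforce
  moreover have "card (\<Union>p\<in>UNIV. S p) = (\<Sum>p\<in>UNIV. card (S p))"
  proof (rule card_UN_disjoint)
    show "\<forall>p\<in>UNIV. finite (S p)" by (simp add: S_def finite_consistent)
    show "\<forall>p\<in>UNIV. \<forall>q\<in>UNIV. p \<noteq> q \<longrightarrow> S p \<inter> S q = {}"
      unfolding S_def by blast
  qed simp
  moreover have "card (S p) = weight w (ends_in_pair (fst p) (snd p)) (fst p) (snd p)" for p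
    using card_consistent[of w "fst p" "snd p" "\<lambda>c e. c = fst p \<and> e = snd p"]
    by (cases p) (simp add: S_def ends_in_pair_def[abs_def])
  ultimately show ?thesis
    by (simp add: num_fixed_points_def sum.cartesian_product case_prod_unfold)
qed

section \<open>Open chains with trimmed ends\<close>

lemma run_ops_dropWhile_zeros:
  "\<exists>h. run_ops h (map nat (dropWhile (\<lambda>k. k = 0) ks)) = run_ops g (map nat ks)"
  by (induction ks arbitrary: g) auto

lemma run_ops_drop_final_zeros:
  "run_ops g (map nat (rev (dropWhile (\<lambda>k. k = 0) (rev ks)))) = run_ops g (map nat ks)"
  by (induction ks rule: rev_induct) (auto simp: run_ops_snoc)

text \<open>
  An empty run at the left end only swaps the roles of the two gates, and one at the right end has no
  effect on the gate list at all.  So zeros may stay in the sequence, and the first gate may be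
  chosen freely.
\<close>

lemma open_fp_run_ops:
  assumes "ks \<noteq> [-1]"
  shows "open_fp ks = (\<Sum>c\<in>UNIV. weight (run_ops g (map nat ks)) ends_equal c c)"
proof -
  let ?zs = "strip_zeros ks"
  obtain h where "run_ops h (map nat ?zs) = run_ops g (map nat ks)"
    using run_ops_dropWhile_zeros[of ks g] run_ops_drop_final_zeros
    by (auto simp: strip_zeros_def)
  moreover have "open_fp ks = (let ops = run_ops h (map nat ?zs)
      in num_fixed_points (length ops + 2) (open_net ops))"
    using assms num_fixed_points_open_start[of h] by (simp add: open_fp_def)
  ultimately show ?thesis by (simp only: Let_def open_fixed_points)
qed

text \<open>
  As \<open>t - s\<close> is even, the first and the last run have the same gate; removing one vertex from each
  of them is removing the first and the last letter of the gate list.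
\<close>

lemma run_ops_trimmed:
  assumes "s < t" "even (t - s)" "k s \<ge> 1" "k t \<ge> 1"
  shows "run_ops g (map k [s..<Suc t]) = g # run_ops g (map nat (trimmed k s t)) @ [g]"
proof -
  obtain a b where ab: "k s = Suc a" "k t = Suc b"
    using assms by (metis Suc_le_D One_nat_def)
  have "run_ops g (map k [s..<Suc t]) =
      replicate (k s) g @ run_ops (dual g) (map k [Suc s..<t] @ [k t])"
    using assms by (simp add: upt_conv_Cons)
  moreover have "map nat (trimmed k s t) = a # map k [Suc s..<t] @ [b]"
    using assms ab by (simp add: trimmed_def comp_def)
  moreover have "odd (length (map k [Suc s..<t]))" using assms by auto
  ultimately show ?thesis using ab
    by (simp add: run_ops_snoc replicate_append_same)
qed

text \<open>
  The removed outer vertices are put back as gates with a neutral outer neighbour, which acts on them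
  as the open ends do.
\<close>

lemma open_fp_trimmed:
  assumes "s \<le> t" "even (t - s)" "k s \<ge> 1" "k t \<ge> 1"
  shows "open_fp (trimmed k s t) =
    weight_from (run_ops g (map k [s..<Suc t])) (ends_in (neutral g)) (neutral g)"
proof (cases "trimmed k s t = [-1]")
  case True
  then have "s = t" "k s = 1" using assms by (auto simp: trimmed_def split: if_splits)
  then show ?thesis using True
    by (simp add: open_fp_def weight_from_neutral ends_in_def UNIV_bool)
next
  case False
  have "run_ops g (map k [s..<Suc t]) = g # run_ops g (map nat (trimmed k s t)) @ [g]"
  proof (cases "s < t")
    case True
    then show ?thesis using assms run_ops_trimmed by blast
  next
    case eq: False
    then have st: "s = t" using assms by simp
    then have "k s \<noteq> 1" using False by (auto simp: trimmed_def)
    then have "2 \<le> k s" using assms by linarith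
    then obtain a where "k s = a + 2" by (metis add.commute le_Suc_ex)
    then show ?thesis using st by (simp add: trimmed_def replicate_append_same)
  qed
  then show ?thesis using open_fp_run_ops[OF False, of g]
    by (simp add: weight_from_neutral weight_append weight_neutral del: weight.simps(2))
qed

section \<open>Conditioning on a short run\<close>

lemma closed_fp_weight:
  assumes "sum_list ks \<ge> 2"
  shows "closed_fp ks = (\<Sum>a\<in>UNIV. \<Sum>b\<in>UNIV. weight (run_ops And ks) (ends_in_pair a b) a b)"
  using closed_fixed_points[of "run_ops And ks"] assms by (simp add: closed_fp_def Let_def)

text \<open>
  The value at the second vertex of the \<open>And\<close> pair equals that at the first.  If it is 0, both
  outer neighbours are free; if it is 1, both outer neighbours are 1.
\<close>

lemma sum_weight_And_And:
  "(\<Sum>a\<in>UNIV. \<Sum>b\<in>UNIV. weight (And # And # w) (ends_in_pair a b) a b) =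
   weight_from w (ends_in False) False + weight w (ends_in_pair True True) True True"
  by (simp add: UNIV_bool weight_from_def flip: weight_sum_ends_in_pair)

text \<open>
  If the value at the \<open>And\<close> vertex is 0, at least one of its neighbours is 0.  The two summands with
  value 0 count the words with a zero on the right and on the left, and the words with zeros on both
  sides are counted twice.
\<close>

lemma sum_weight_And:
  "(\<Sum>a\<in>UNIV. \<Sum>b\<in>UNIV. weight (And # w) (ends_in_pair a b) a b) +
     weight w (ends_in_pair False False) False False =
   weight w (ends_in_pair True True) True True + weight w (ends_in False) False False +
     weight_from w (ends_in_pair False False) False"
  by (simp add: UNIV_bool weight_from_def flip: weight_sum_ends_in_pair)

lemma run_ops_upt_Cons:
  "s < t \<Longrightarrow> run_ops g (map k [s..<t]) = replicate (k s) g @ run_ops (dual g) (map k [Suc s..<t])"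
  by (simp add: upt_conv_Cons)

lemma run_ops_upt_snoc:
  "s \<le> t \<Longrightarrow> run_ops g (map k [s..<Suc t]) =
    run_ops g (map k [s..<t]) @ replicate (k t) (if even (t - s) then g else dual g)"
  by (simp add: run_ops_snoc)

text \<open>
  In the following lemmas the gate list \<open>run_ops Or (map k [2..<Suc r])\<close> is the cycle without the
  short \<open>And\<close> run.  It starts and ends with an \<open>Or\<close> run since \<open>r\<close> is even.
\<close>

context
  fixes k :: "nat \<Rightarrow> nat" and r :: nat
  assumes r: "r \<ge> 4" "even r"
    and pos: "\<And>i. 2 \<le> i \<Longrightarrow> i \<le> r \<Longrightarrow> k i \<ge> 1"
begin

text \<open>
  One is absorbing for \<open>Or\<close>, so it sweeps through the first run from the left and through the
  last run from the right, and arrives at an \<open>And\<close> run on either side, where it is neutral.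
\<close>

lemma weight_all_ones:
  "weight (run_ops Or (map k [2..<Suc r])) (ends_in_pair True True) True True =
   open_fp (trimmed k 3 (r - 1))"
proof -
  have "run_ops Or (map k [2..<Suc r]) =
      replicate (k 2) Or @ run_ops And (map k [3..<r]) @ replicate (k r) Or"
    using r by (simp add: run_ops_upt_snoc run_ops_upt_Cons[of 2] del: upt_Suc)
  then have "weight (run_ops Or (map k [2..<Suc r])) (ends_in_pair True True) True True =
      weight_from (run_ops And (map k [3..<r])) (ends_in True) True"
    using r pos
    by (simp add: weight_pair_absorbing weight_from_append weight_ends_in_pair_absorbing)
  also have "\<dots> = open_fp (trimmed k 3 (r - 1))"
    using r pos open_fp_trimmed[of 3 "r - 1" k And] by simp
  finally show ?thesis .
qed

lemma weight_from_all:
  "weight_from (run_ops Or (map k [2..<Suc r])) (ends_in False) False = open_fp (trimmed k 2 r)"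
  using r pos open_fp_trimmed[of 2 r k Or] by simp

lemma run_ops_first_two:
  "run_ops Or (map k [2..<Suc r]) =
   replicate (k 2) Or @ replicate (k 3) And @ run_ops Or (map k [4..<Suc r])"
  using r by (simp add: run_ops_upt_Cons[of 2] run_ops_upt_Cons[of 3] del: upt_Suc)

lemma run_ops_last_two:
  "run_ops Or (map k [2..<Suc r]) =
   run_ops Or (map k [2..<Suc (r - 2)]) @ replicate (k (r - 1)) And @ replicate (k r) Or"
proof -
  obtain m where "r = Suc (Suc m)" "m \<ge> 2" "even m"
    using r by (cases r; cases "r - 1") auto
  then show ?thesis by (simp add: run_ops_upt_snoc del: upt_Suc)
qed

text \<open>
  Two adjacent zeros clear the first \<open>Or\<close> run.  They reach the following \<open>And\<close> run as an absorbing
  value, clear it as well, and meet run 4 as a neutral value.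
\<close>

lemma weight_first_zero:
  "weight (run_ops Or (map k [2..<Suc r])) (ends_in False) False False = open_fp (trimmed k 4 r)"
  using r pos open_fp_trimmed[of 4 r k Or]
  by (simp add: run_ops_first_two weight_pair_neutral weight_pair_absorbing del: upt_Suc)

lemma weight_last_zero:
  "weight_from (run_ops Or (map k [2..<Suc r])) (ends_in_pair False False) False =
   open_fp (trimmed k 2 (r - 2))"
  using r pos open_fp_trimmed[of 2 "r - 2" k Or]
  by (simp add: run_ops_last_two weight_from_append weight_append weight_ends_in_pair_neutral
      weight_ends_in_pair_absorbing del: upt_Suc)

text \<open>
  The zeros clear two runs from each side.  For \<open>r = 4\<close> there are only three runs and the sweeps meet
  in the middle one, so all values are forced; the single solution is the conventional value of the
  sequence \<open>(-1)\<close>.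
\<close>

lemma weight_both_zero:
  "weight (run_ops Or (map k [2..<Suc r])) (ends_in_pair False False) False False =
   open_fp (trimmed k 4 (r - 2))"
proof (cases "r = 4")
  case True
  have "weight (run_ops Or (map k [2..<Suc r])) (ends_in_pair False False) False False =
      weight (replicate (k 2) Or) (ends_in False) False False"
    using pos[of 3] True
    by (simp add: run_ops_last_two weight_append weight_ends_in_pair_neutral
        weight_ends_in_pair_absorbing del: upt_Suc)
  also have "\<dots> = 1"
    using weight_pair_neutral[of Or False "k 2" "[]"] by (simp add: ends_in_def)
  finally show ?thesis using True by (simp add: trimmed_def open_fp_def)
next
  case False
  then have r6: "r \<ge> 6" using r by presburger
  have "run_ops Or (map k [2..<Suc (r - 2)]) =
      replicate (k 2) Or @ replicate (k 3) And @ run_ops Or (map k [4..<Suc (r - 2)])"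
    using r6 by (simp add: run_ops_upt_Cons[of 2] run_ops_upt_Cons[of 3] del: upt_Suc)
  then have "run_ops Or (map k [2..<Suc r]) = replicate (k 2) Or @ replicate (k 3) And @
      run_ops Or (map k [4..<Suc (r - 2)]) @ replicate (k (r - 1)) And @ replicate (k r) Or"
    by (simp add: run_ops_last_two del: upt_Suc)
  then have "weight (run_ops Or (map k [2..<Suc r])) (ends_in_pair False False) False False =
      weight_from (run_ops Or (map k [4..<Suc (r - 2)])) (ends_in False) False"
    using r6 pos by (simp add: weight_pair_neutral weight_pair_absorbing weight_from_append
        del: upt_Suc)
      (simp add: weight_append weight_ends_in_pair_neutral weight_ends_in_pair_absorbing
        del: upt_Suc)
  then show ?thesis
    using r r6 pos open_fp_trimmed[of 4 "r - 2" k Or] by (simp del: upt_Suc)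
qed

lemma closed_fp_two:
  "closed_fp (2 # map k [2..<Suc r]) = open_fp (trimmed k 2 r) + open_fp (trimmed k 3 (r - 1))"
proof -
  have "run_ops And (2 # map k [2..<Suc r]) = And # And # run_ops Or (map k [2..<Suc r])"
    by (simp add: numeral_2_eq_2 del: upt_Suc)
  then show ?thesis
    using closed_fp_weight[of "2 # map k [2..<Suc r]"]
    by (simp only: sum_weight_And_And weight_all_ones weight_from_all) simp
qed

lemma closed_fp_one:
  "closed_fp (1 # map k [2..<Suc r]) + open_fp (trimmed k 4 (r - 2)) =
   open_fp (trimmed k 3 (r - 1)) + open_fp (trimmed k 4 r) + open_fp (trimmed k 2 (r - 2))"
proof -
  have "run_ops And (1 # map k [2..<Suc r]) = And # run_ops Or (map k [2..<Suc r])"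
    by (simp del: upt_Suc)
  moreover have "sum_list (1 # map k [2..<Suc r]) \<ge> 2"
    using r pos[of 2] by (simp add: upt_conv_Cons del: upt_Suc)
  ultimately show ?thesis
    using closed_fp_weight[of "1 # map k [2..<Suc r]"]
      sum_weight_And[of "run_ops Or (map k [2..<Suc r])"]
    by (simp only: weight_all_ones weight_first_zero weight_last_zero weight_both_zero)
qed

end

section \<open>Closed chains with at most two runs\<close>

text \<open>
  The transfer matrix of a gate has the same second and third power, so for the trace all runs of
  length at least 2 are alike.
\<close>

lemma weight_replicate:
  assumes "m \<ge> 2"
  shows "weight (replicate m g) = weight [g, g]"
proof -
  have idem: "weight [g, g, g] = weight [g, g]"
    by (intro ext, cases g) (auto simp: UNIV_bool)
  have "weight (replicate (l + 2) g) = weight [g, g]" for l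
  proof (induction l)
    case (Suc l)
    have "weight (replicate (Suc l + 2) g) \<phi> = weight [g, g, g] \<phi>" for \<phi>
      using weight_Cons[of g "replicate (l + 2) g" \<phi>] weight_Cons[of g "[g, g]" \<phi>]
      by (simp only: Suc replicate_Suc add_Suc)
    then show ?case unfolding idem by (rule ext)
  qed (simp add: numeral_2_eq_2)
  then show ?thesis using assms by (metis add.commute le_Suc_ex)
qed

lemma closed_fp_single: "k \<ge> 2 \<Longrightarrow> closed_fp [k] = 2"
  by (simp add: closed_fp_weight weight_replicate UNIV_bool ends_in_pair_def)

lemma closed_fp_long_one: "k \<ge> 2 \<Longrightarrow> closed_fp [k, 1] = 2"
  by (simp add: closed_fp_weight weight_append weight_replicate UNIV_bool ends_in_pair_def)

lemma closed_fp_long_long: "k1 \<ge> 2 \<Longrightarrow> k2 \<ge> 2 \<Longrightarrow> closed_fp [k1, k2] = 3"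
  by (simp add: closed_fp_weight weight_append weight_replicate UNIV_bool ends_in_pair_def)

theorem theorem3p4:
  shows "(\<forall>(r :: nat) (k :: nat \<Rightarrow> nat). r \<ge> 4 \<and> even r \<and> (\<forall>i\<in>{2..r}. k i \<ge> 1) \<longrightarrow>
        int (closed_fp (2 # map k [2..<r + 1])) =
          int (open_fp (trimmed k 2 r)) + int (open_fp (trimmed k 3 (r - 1))) \<and>
        int (closed_fp (1 # map k [2..<r + 1])) =
          int (open_fp (trimmed k 3 (r - 1))) + int (open_fp (trimmed k 4 r))
          + int (open_fp (trimmed k 2 (r - 2))) - int (open_fp (trimmed k 4 (r - 2)))) \<and>
    (\<forall>k :: nat. k \<ge> 3 \<longrightarrow> closed_fp [k] = 2) \<and>
    (\<forall>k :: nat. k \<ge> 2 \<longrightarrow> closed_fp [k, 1] = 2) \<and>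
    (\<forall>(k1 :: nat) (k2 :: nat). k1 \<ge> 2 \<and> k2 \<ge> 2 \<longrightarrow> closed_fp [k1, k2] = 3)"
proof (intro conjI allI impI)
  fix r :: nat and k :: "nat \<Rightarrow> nat"
  assume "r \<ge> 4 \<and> even r \<and> (\<forall>i\<in>{2..r}. k i \<ge> 1)"
  then have r: "r \<ge> 4" "even r" and pos: "\<And>i. 2 \<le> i \<Longrightarrow> i \<le> r \<Longrightarrow> k i \<ge> 1"
    by auto
  show "int (closed_fp (2 # map k [2..<r + 1])) =
      int (open_fp (trimmed k 2 r)) + int (open_fp (trimmed k 3 (r - 1)))"
    using closed_fp_two[where k = k, OF r pos] by (simp del: upt_Suc)
  show "int (closed_fp (1 # map k [2..<r + 1])) =
      int (open_fp (trimmed k 3 (r - 1))) + int (open_fp (trimmed k 4 r))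
      + int (open_fp (trimmed k 2 (r - 2))) - int (open_fp (trimmed k 4 (r - 2)))"
    using closed_fp_one[where k = k, OF r pos] by (simp del: upt_Suc)
qed (auto intro!: closed_fp_single closed_fp_long_one closed_fp_long_long simp del: One_nat_def)

end
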